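(* Consider the discrete-time piecewise affine system $x_{t+1}=F(x_t,u_t)$, a goal polytope $\mathbb{X}_{\text{goal}}$, stage costs $\gamma_i$, and a polytopic tree with nodes $\mathcal V$, root $v_0$, polytopes $\mathbb{X}_v$, local control parameters $\bar u_v,\theta_v$, and cost-to-go function $V:\mathcal V\to\mathbb{R}$, all as defined in the context, and let $\mathbb{X}_{\text{tree}}=\bigcup_{v\in\mathcal V}\mathbb{X}_v$. Let $\mu_{\mathbb{X}_{\text{tree}}}:\mathbb{X}_{\text{tree}}\to\mathbb{U}$ be $$\mu_{\mathbb{X}_{\text{tree}}}(x)=\bar u_{v^*}+\theta_{v^*}\,p_{v^*}(x),\qquad v^*=v^*(x)\in\arg\min_{v\in\mathcal V}\{V(v)\mid x\in\mathbb{X}_v\}.$$ Then, given $x_0\in\mathbb{X}_{\text{tree}}$, implementing $\mu_{\mathbb{X}_{\text{tree}}}$ (i.e. $u_t=\mu_{\mathbb{X}_{\text{tree}}}(x_t)$, $x_{t+1}=F(x_t,u_t)$, until the goal is reached) yields, for some $T\in\mathbb{N}$, a trajectory $x_0,\dots,x_T$ such that $x_\tau\in\mathbb{X}_{\text{tree}}$ for $\tau=0,\dots,T$, $x_T\in\mathbb{X}_{\text{goal}}$, and the total cost $$J=\sum_{t=0}^{T-1}\gamma_{i_t}(x_t,u_t),\qquad (x_t,u_t)\in\mathbb{H}_{i_t},$$ is upper bounded by $V(v^*(x_0))$.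
   Context: **System.** A polytope is a bounded set of the form $\{x\in\mathbb{R}^n\mid Hx\le h\}$. $\mathbb{X}\subset\mathbb{R}^n$ and $\mathbb{U}\subset\mathbb{R}^m$ are the state and input spaces; $\mathbb{X}\times\mathbb{U}$ is partitioned into finitely many polytopes $\mathbb{H}_i$, $i\in\mathcal M=\{1,\dots,n_{\mathcal M}\}$; $F:\mathbb{X}\times\mathbb{U}\to\mathbb{X}$ is $F(x,u)=A_ix+B_iu+c_i$ for $(x,u)\in\mathbb{H}_i$. $\mathbb{X}_{\text{goal}}\subset\mathbb{X}$ is a polytope. Stage costs are functions $\gamma_i:\mathbb{H}_i\to\mathbb{R}$. **Tree.** Fix a base polytope $\mathbb{P}\subset\mathbb{R}^{n_p}$. The tree is a finite directed rooted tree with node set $\mathcal V$, root $v_0$, and a map $\mathrm{child}:\mathcal V\setminus\{v_0\}\to\mathcal V$ sending each non-root node to its unique successor, such that following successors from any node leads to $v_0$. Each node $v$ carries a polytope $\mathbb{X}_v\subseteq\mathbb{X}$, with $\mathbb{X}_{v_0}=\mathbb{X}_{\text{goal}}$. For each $v\ne v_0$, $\mathbb{X}_v=\{\bar x_v\}+G_v\mathbb{P}$ with $\bar x_v\in\mathbb{R}^n$, $G_v\in\mathbb{R}^{n\times n_p}$, and there are $\bar u_v\in\mathbb{R}^m$, $\theta_v\in\mathbb{R}^{m\times n_p}$ and a mode $i=i(v)\in\mathcal M$ with $$\mathbb{X}_v\times(\{\bar u_v\}+\theta_v\mathbb{P})\subseteq\mathbb{H}_i,\qquad \{A_i(\bar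 x_v+G_vp)+B_i(\bar u_v+\theta_vp)+c_i\mid p\in\mathbb{P}\}\subseteq\mathbb{X}_{\mathrm{child}(v)}.$$ For $x\in\mathbb{X}_v$, $p_v(x)$ denotes an element of $\mathbb{P}$ with $x=\bar x_v+G_vp_v(x)$ (equal to $G_v^{-1}(x-\bar x_v)$ if $n_p=n$ and $G_v$ is invertible). The root carries no control law, since at the root the goal has been reached. **Costs.** For $v\ne v_0$ with mode $i=i(v)$, the worst-case one-step cost is $\mathcal C(v)=\max_{p\in\mathbb{P}}\gamma_i(\bar x_v+G_vp,\ \bar u_v+\theta_vp)$ (assumed to be available). The cost-to-go is defined recursively by $V(v_0)=0$ and $V(v)=\mathcal C(v)+V(\mathrm{child}(v))$ for $v\neq v_0$.
   Formalization: The worst-case one-step costs C(v) are assumed strictly positive at all non-root nodes (with zero or negative costs the policy may never reach the goal), and where polytopes H_i, H_j share points the stage costs are assumed to agree there, so that J is well defined. *)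

theory Defs
  imports "HOL-Analysis.Analysis"
begin

(* Half-space representation {x. H x <= h}, bounded.  It agrees with the vertex
   representation by polytope_eq_bounded_polyhedron. *)
definition h_polytope :: "'a::euclidean_space set \<Rightarrow> bool" where
  "h_polytope S \<longleftrightarrow> polyhedron S \<and> bounded S"

(* Stage costs are total functions here; stage_cost S i is only ever used on region S i. *)
record ('n::finite, 'm::finite) pwa =
  states :: "(real ^ 'n) set"
  inputs :: "(real ^ 'm) set"
  num_modes :: nat
  region :: "nat \<Rightarrow> ((real ^ 'n) \<times> (real ^ 'm)) set"
  mat_A :: "nat \<Rightarrow> real ^ 'n ^ 'n"
  mat_B :: "nat \<Rightarrow> real ^ 'm ^ 'n"
  vec_c :: "nat \<Rightarrow> real ^ 'n"
  dynamics :: "real ^ 'n \<Rightarrow> real ^ 'm \<Rightarrow> real ^ 'n"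
  goal :: "(real ^ 'n) set"
  stage_cost :: "nat \<Rightarrow> real ^ 'n \<Rightarrow> real ^ 'm \<Rightarrow> real"

definition modes :: "('n::finite, 'm::finite) pwa \<Rightarrow> nat set" where
  "modes S = {1..num_modes S}"

definition mode_map ::
  "('n::finite, 'm::finite) pwa \<Rightarrow> nat \<Rightarrow> real ^ 'n \<Rightarrow> real ^ 'm \<Rightarrow> real ^ 'n" where
  "mode_map S i x u = mat_A S i *v x + mat_B S i *v u + vec_c S i"

(* The regions are closed, so they are a partition in the sense usual for piecewise affine
   systems: they cover states x inputs and can meet only along their boundaries.  Pairwise
   disjoint regions are the special case where the third and the last conjunct are trivial.
   On common boundary points the dynamics is single-valued because it is a function; the last
   conjunct asks the same of the stage cost, so that the cost of a trajectory does not depend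
   on which of the modes of a boundary point is used. *)
definition pwa_system :: "('n::finite, 'm::finite) pwa \<Rightarrow> bool" where
  "pwa_system S \<longleftrightarrow>
     (\<forall>i\<in>modes S. h_polytope (region S i)) \<and>
     (\<Union>i\<in>modes S. region S i) = states S \<times> inputs S \<and>
     (\<forall>i\<in>modes S. \<forall>j\<in>modes S. i \<noteq> j \<longrightarrow> interior (region S i) \<inter> interior (region S j) = {}) \<and>
     (\<forall>x\<in>states S. \<forall>u\<in>inputs S. dynamics S x u \<in> states S) \<and>
     (\<forall>i\<in>modes S. \<forall>(x, u)\<in>region S i. dynamics S x u = mode_map S i x u) \<and>
     h_polytope (goal S) \<and> goal S \<subseteq> states S \<and>
     (\<forall>i\<in>modes S. \<forall>j\<in>modes S. \<forall>(x, u)\<in>region S i \<inter> region S j.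
        stage_cost S i x u = stage_cost S j x u)"

(* The fields child, center, gen, u_bar, theta and node_mode are meaningful only at non-root nodes. *)
record ('v, 'n::finite, 'm::finite, 'p::finite) ptree =
  base :: "(real ^ 'p) set"
  nodes :: "'v set"
  root_node :: 'v
  child :: "'v \<Rightarrow> 'v"
  node_set :: "'v \<Rightarrow> (real ^ 'n) set"
  center :: "'v \<Rightarrow> real ^ 'n"
  gen :: "'v \<Rightarrow> real ^ 'p ^ 'n"
  u_bar :: "'v \<Rightarrow> real ^ 'm"
  theta :: "'v \<Rightarrow> real ^ 'p ^ 'm"
  node_mode :: "'v \<Rightarrow> nat"

definition state_at ::
  "('v, 'n::finite, 'm::finite, 'p::finite) ptree \<Rightarrow> 'v \<Rightarrow> real ^ 'p \<Rightarrow> real ^ 'n" where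
  "state_at T v p = center T v + gen T v *v p"

definition input_at ::
  "('v, 'n::finite, 'm::finite, 'p::finite) ptree \<Rightarrow> 'v \<Rightarrow> real ^ 'p \<Rightarrow> real ^ 'm" where
  "input_at T v p = u_bar T v + theta T v *v p"

definition polytopic_tree ::
  "('n::finite, 'm::finite) pwa \<Rightarrow> ('v, 'n, 'm, 'p::finite) ptree \<Rightarrow> bool" where
  "polytopic_tree S T \<longleftrightarrow>
     h_polytope (base T) \<and>
     finite (nodes T) \<and> root_node T \<in> nodes T \<and>
     (\<forall>v\<in>nodes T - {root_node T}. child T v \<in> nodes T) \<and>
     (\<forall>v\<in>nodes T. \<exists>k. (child T ^^ k) v = root_node T) \<and>
     (\<forall>v\<in>nodes T. h_polytope (node_set T v) \<and> node_set T v \<subseteq> states S) \<and>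
     node_set T (root_node T) = goal S \<and>
     (\<forall>v\<in>nodes T - {root_node T}.
        node_set T v = state_at T v ` base T \<and>
        node_mode T v \<in> modes S \<and>
        node_set T v \<times> (input_at T v ` base T) \<subseteq> region S (node_mode T v) \<and>
        (\<lambda>p. mode_map S (node_mode T v) (state_at T v p) (input_at T v p)) ` base T
          \<subseteq> node_set T (child T v))"

definition tree_set :: "('v, 'n::finite, 'm::finite, 'p::finite) ptree \<Rightarrow> (real ^ 'n) set" where
  "tree_set T = (\<Union>v\<in>nodes T. node_set T v)"

definition node_cost ::
  "('n::finite, 'm::finite) pwa \<Rightarrow> ('v, 'n, 'm, 'p::finite) ptree \<Rightarrow> 'v \<Rightarrow> real ^ 'p \<Rightarrow> real" where
  "node_cost S T v p = stage_cost S (node_mode T v) (state_at T v p) (input_at T v p)"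

(* The maximum over the base polytope; unspecified unless it is attained. *)
definition worst_cost ::
  "('n::finite, 'm::finite) pwa \<Rightarrow> ('v, 'n, 'm, 'p::finite) ptree \<Rightarrow> 'v \<Rightarrow> real" where
  "worst_cost S T v = (GREATEST c. c \<in> node_cost S T v ` base T)"

definition worst_cost_exists ::
  "('n::finite, 'm::finite) pwa \<Rightarrow> ('v, 'n, 'm, 'p::finite) ptree \<Rightarrow> 'v \<Rightarrow> bool" where
  "worst_cost_exists S T v \<longleftrightarrow> (\<exists>p\<in>base T. \<forall>q\<in>base T. node_cost S T v q \<le> node_cost S T v p)"

(* The recursion determines V on nodes T, since following child leads to the root. *)
definition cost_to_go ::
  "('n::finite, 'm::finite) pwa \<Rightarrow> ('v, 'n, 'm, 'p::finite) ptree \<Rightarrow> ('v \<Rightarrow> real) \<Rightarrow> bool" where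
  "cost_to_go S T V \<longleftrightarrow>
     V (root_node T) = 0 \<and>
     (\<forall>v\<in>nodes T - {root_node T}. V v = worst_cost S T v + V (child T v))"

definition parameter_choice ::
  "('v, 'n::finite, 'm::finite, 'p::finite) ptree \<Rightarrow> ('v \<Rightarrow> real ^ 'n \<Rightarrow> real ^ 'p) \<Rightarrow> bool" where
  "parameter_choice T pv \<longleftrightarrow>
     (\<forall>v\<in>nodes T - {root_node T}. \<forall>x\<in>node_set T v. pv v x \<in> base T \<and> x = state_at T v (pv v x))"

definition best_node_choice ::
  "('v, 'n::finite, 'm::finite, 'p::finite) ptree \<Rightarrow> ('v \<Rightarrow> real) \<Rightarrow> (real ^ 'n \<Rightarrow> 'v) \<Rightarrow> bool" where
  "best_node_choice T V vstar \<longleftrightarrow>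
     (\<forall>x\<in>tree_set T. is_arg_min V (\<lambda>v. v \<in> nodes T \<and> x \<in> node_set T v) (vstar x))"

(* Carries information only where vstar x is not the root. *)
definition tree_policy ::
  "('v, 'n::finite, 'm::finite, 'p::finite) ptree \<Rightarrow> ('v \<Rightarrow> real ^ 'n \<Rightarrow> real ^ 'p) \<Rightarrow>
   (real ^ 'n \<Rightarrow> 'v) \<Rightarrow> real ^ 'n \<Rightarrow> real ^ 'm" where
  "tree_policy T pv vstar x = input_at T (vstar x) (pv (vstar x) x)"

end

theory Submission
  imports Defs
begin

text \<open>The cost-to-go of the selected node is a Lyapunov function: one step from \<open>x\<close>, controlled by
  the node \<open>v = vstar x\<close>, lands in the polytope of \<open>child T v\<close>, so the minimising choice at the
  successor has cost-to-go at most \<open>V (child T v) = V v - worst_cost S T v\<close>. As there are finitely many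
  nodes and the decrease is strict, the goal is reached; summing the decreases bounds the cost.\<close>

text \<open>\<open>GREATEST\<close> has a usable value only when the maximum is attained; the
  maximiser supplied by \<open>worst_cost_exists\<close> pins it down.\<close>

lemma worst_cost_upper:
  assumes "worst_cost_exists S T v" "p \<in> base T"
  shows "node_cost S T v p \<le> worst_cost S T v"
proof -
  obtain q where q: "q \<in> base T" "\<forall>p\<in>base T. node_cost S T v p \<le> node_cost S T v q"
    using assms(1) unfolding worst_cost_exists_def by blast
  have "worst_cost S T v = node_cost S T v q"
    unfolding worst_cost_def by (rule Greatest_equality) (use q in auto)
  then show ?thesis
    using q assms(2) by simp
qed

text \<open>Unrolling the recursion along \<open>child\<close> writes \<open>V v\<close> as a sum of
  worst-case costs ending in 0 at the root. This settles trajectories that start in the goal, whose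
  empty cost must not exceed the claimed bound.\<close>

lemma cost_to_go_nonneg:
  assumes tree: "polytopic_tree S T" and V: "cost_to_go S T V"
    and nonneg: "\<forall>v\<in>nodes T - {root_node T}. 0 \<le> worst_cost S T v"
    and v: "v \<in> nodes T"
  shows "0 \<le> V v"
proof -
  have "\<forall>w\<in>nodes T. (child T ^^ k) w = root_node T \<longrightarrow> 0 \<le> V w" for k
  proof (induction k)
    case 0
    then show ?case using V by (simp add: cost_to_go_def)
  next
    case (Suc k)
    show ?case
    proof (intro ballI impI)
      fix w assume w: "w \<in> nodes T" and reach: "(child T ^^ Suc k) w = root_node T"
      show "0 \<le> V w"
      \<comment> \<open>\<open>child\<close> is unconstrained at the root, so the iteration may
        leave the root and come back; the root is therefore treated apart even for a positive number
        of steps.\<close>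
      proof (cases "w = root_node T")
        case True
        then show ?thesis using V by (simp add: cost_to_go_def)
      next
        case False
        then have "child T w \<in> nodes T"
          using tree w by (simp add: polytopic_tree_def)
        moreover have "(child T ^^ k) (child T w) = root_node T"
          using reach by (simp add: funpow_swap1)
        ultimately have "0 \<le> V (child T w)"
          using Suc.IH by blast
        then show ?thesis
          using V nonneg w False by (simp add: cost_to_go_def)
      qed
    qed
  qed
  moreover have "\<exists>k. (child T ^^ k) v = root_node T"
    using tree v by (simp add: polytopic_tree_def)
  ultimately show ?thesis
    using v by blast
qed

lemma best_node_in:
  assumes "best_node_choice T V vstar" "x \<in> tree_set T"
  shows "vstar x \<in> nodes T" "x \<in> node_set T (vstar x)"
  using assms by (auto simp: best_node_choice_def is_arg_min_def)

lemma best_node_le: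
  assumes "best_node_choice T V vstar" "v \<in> nodes T" "x \<in> node_set T v"
  shows "V (vstar x) \<le> V v"
  using assms by (force simp: best_node_choice_def is_arg_min_def tree_set_def)

text \<open>One closed-loop step outside the goal. The last claim covers every mode whose region
  contains \<open>(x, u)\<close>, since regions may share boundary points and the bound on the total
  cost must hold for any choice of modes.\<close>

lemma tree_policy_step:
  fixes S :: "('n::finite, 'm::finite) pwa"
    and T :: "('v, 'n, 'm, 'p::finite) ptree"
  assumes system: "pwa_system S"
    and tree: "polytopic_tree S T"
    and max_exists: "\<forall>v\<in>nodes T - {root_node T}. worst_cost_exists S T v"
    and V: "cost_to_go S T V"
    and pv: "parameter_choice T pv"
    and vstar: "best_node_choice T V vstar"
    and x: "x \<in> tree_set T" and not_goal: "x \<notin> goal S"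
  defines "u \<equiv> tree_policy T pv vstar x"
  shows "\<exists>i\<in>modes S. (x, u) \<in> region S i"
    and "dynamics S x u \<in> tree_set T"
    and "V (vstar (dynamics S x u)) + worst_cost S T (vstar x) \<le> V (vstar x)"
    and "vstar x \<in> nodes T - {root_node T}"
    and "\<And>i. i \<in> modes S \<Longrightarrow> (x, u) \<in> region S i \<Longrightarrow>
      stage_cost S i x u \<le> worst_cost S T (vstar x)"
proof -
  define v where "v = vstar x"
  define p where "p = pv v x"
  have xv: "x \<in> node_set T v"
    using best_node_in[OF vstar x] by (simp add: v_def)
  \<comment> \<open>The polytope of the root is the goal itself, so a state outside the goal cannot
    select the root.\<close>
  have v: "v \<in> nodes T - {root_node T}"
    using best_node_in[OF vstar x] not_goal tree by (auto simp: v_def polytopic_tree_def)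
  then show "vstar x \<in> nodes T - {root_node T}" by (simp add: v_def)
  have p: "p \<in> base T" "state_at T v p = x"
    using pv v xv unfolding parameter_choice_def p_def by metis+
  have u: "u = input_at T v p"
    by (simp add: u_def tree_policy_def v_def p_def)
  let ?i = "node_mode T v"
  have child: "child T v \<in> nodes T"
    using tree v by (simp add: polytopic_tree_def)
  have "node_set T v = state_at T v ` base T \<and> ?i \<in> modes S \<and>
      node_set T v \<times> (input_at T v ` base T) \<subseteq> region S ?i \<and>
      (\<lambda>p. mode_map S ?i (state_at T v p) (input_at T v p)) ` base T \<subseteq> node_set T (child T v)"
    using tree unfolding polytopic_tree_def by (elim conjE) (rule bspec[OF _ v])
  then have i: "?i \<in> modes S"
    and prod: "node_set T v \<times> (input_at T v ` base T) \<subseteq> region S ?i"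
    and step: "(\<lambda>p. mode_map S ?i (state_at T v p) (input_at T v p)) ` base T
      \<subseteq> node_set T (child T v)"
    by - (elim conjE, assumption)+
  have reg: "(x, u) \<in> region S ?i"
    using prod xv p u by blast
  show "\<exists>i\<in>modes S. (x, u) \<in> region S i"
    using i reg by blast
  have "dynamics S x u = mode_map S ?i x u"
    using system i reg by (auto simp: pwa_system_def)
  then have next_in: "dynamics S x u \<in> node_set T (child T v)"
    using step p u by auto
  then show "dynamics S x u \<in> tree_set T"
    using child by (auto simp: tree_set_def)
  \<comment> \<open>\<open>child T v\<close> is a candidate in the minimisation at the successor
    state, and its cost-to-go is \<open>V v\<close> minus the worst cost of
    \<open>v\<close>.\<close>
  show "V (vstar (dynamics S x u)) + worst_cost S T (vstar x) \<le> V (vstar x)"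
    using best_node_le[OF vstar child next_in] V v by (simp add: cost_to_go_def v_def)
  fix j assume j: "j \<in> modes S" "(x, u) \<in> region S j"
  have "\<forall>i\<in>modes S. \<forall>j\<in>modes S. \<forall>(x, u)\<in>region S i \<inter> region S j.
      stage_cost S i x u = stage_cost S j x u"
    using system by (simp add: pwa_system_def)
  \<comment> \<open>Stage costs agree on overlaps of regions, so an arbitrary mode \<open>j\<close>
    reduces to the mode of the node.\<close>
  then have "stage_cost S j x u = stage_cost S ?i x u"
    using i reg j by blast
  also have "\<dots> = node_cost S T v p"
    using p u by (simp add: node_cost_def)
  also have "\<dots> \<le> worst_cost S T v"
    using max_exists v p by (intro worst_cost_upper) auto
  finally show "stage_cost S j x u \<le> worst_cost S T (vstar x)"
    by (simp add: v_def)
qed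

theorem theorem2:
  fixes S :: "('n::finite, 'm::finite) pwa"
    and T :: "('v, 'n, 'm, 'p::finite) ptree"
    and V :: "'v \<Rightarrow> real"
    and pv :: "'v \<Rightarrow> real ^ 'n \<Rightarrow> real ^ 'p"
    and vstar :: "real ^ 'n \<Rightarrow> 'v"
    and x0 :: "real ^ 'n"
  assumes system: "pwa_system S"
    and tree: "polytopic_tree S T"
    and max_exists: "\<forall>v\<in>nodes T - {root_node T}. worst_cost_exists S T v"
    and positive: "\<forall>v\<in>nodes T - {root_node T}. 0 < worst_cost S T v"
    and V: "cost_to_go S T V"
    and pv: "parameter_choice T pv"
    and vstar: "best_node_choice T V vstar"
    and x0: "x0 \<in> tree_set T"
  shows "\<exists>N x u.
           x 0 = x0 \<and>
           (\<forall>t<N. x t \<notin> goal S \<and> u t = tree_policy T pv vstar (x t) \<and>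
                  x (Suc t) = dynamics S (x t) (u t)) \<and>
           (\<forall>t\<le>N. x t \<in> tree_set T) \<and>
           x N \<in> goal S \<and>
           (\<forall>t<N. \<exists>i\<in>modes S. (x t, u t) \<in> region S i) \<and>
           (\<forall>i. (\<forall>t<N. i t \<in> modes S \<and> (x t, u t) \<in> region S (i t)) \<longrightarrow>
                (\<Sum>t<N. stage_cost S (i t) (x t) (u t)) \<le> V (vstar x0))"
proof -
  let ?pol = "tree_policy T pv vstar"
  define f where "f x = dynamics S x (?pol x)" for x
  note step = tree_policy_step[OF system tree max_exists V pv vstar]
  have nonneg: "0 \<le> V v" if "v \<in> nodes T" for v
    using cost_to_go_nonneg[OF tree V _ that] positive by (simp add: less_imp_le)
  \<comment> \<open>The trajectory is the orbit of the closed-loop map \<open>f\<close>. The start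
    \<open>y\<close> and the mode sequence \<open>i\<close> stay general, because the induction
    passes to \<open>f y\<close> and to the sequence shifted by one.\<close>
  have "\<exists>N. (\<forall>t<N. (f ^^ t) y \<notin> goal S) \<and> (\<forall>t\<le>N. (f ^^ t) y \<in> tree_set T) \<and>
          (f ^^ N) y \<in> goal S \<and>
          (\<forall>i. (\<forall>t<N. i t \<in> modes S \<and> ((f ^^ t) y, ?pol ((f ^^ t) y)) \<in> region S (i t)) \<longrightarrow>
            (\<Sum>t<N. stage_cost S (i t) ((f ^^ t) y) (?pol ((f ^^ t) y))) \<le> V (vstar y))"
    if "y \<in> tree_set T" for y
    using that
  \<comment> \<open>Counting the nodes strictly cheaper than the selected one turns a strict
    decrease of real values into a decrease of a natural number.\<close>
  proof (induction "card {w \<in> nodes T. V w < V (vstar y)}" arbitrary: y rule: less_induct)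
    case less
    show ?case
    proof (cases "y \<in> goal S")
      case True
      then show ?thesis
        using less.prems nonneg best_node_in[OF vstar] by (intro exI[of _ 0]) simp
    next
      case False
      note st = step[OF less.prems False, folded f_def]
      have lt: "V (vstar (f y)) < V (vstar y)"
        using st(3) bspec[OF positive st(4)] by linarith
      have "finite (nodes T)"
        using tree by (simp add: polytopic_tree_def)
      moreover have "vstar (f y) \<in> nodes T"
        using best_node_in[OF vstar st(2)] by simp
      \<comment> \<open>The inclusion is strict: \<open>vstar (f y)\<close> lies in the larger set
        but not in the smaller one.\<close>
      ultimately have "card {w \<in> nodes T. V w < V (vstar (f y))} < card {w \<in> nodes T. V w < V (vstar y)}"
        using lt by (intro psubset_card_mono) auto
      from less.hyps[OF this st(2)] obtain N
        where N: "\<forall>t<N. (f ^^ t) (f y) \<notin> goal S" "\<forall>t\<le>N. (f ^^ t) (f y) \<in> tree_set T"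
          "(f ^^ N) (f y) \<in> goal S"
          and cost: "\<And>i. \<forall>t<N. i t \<in> modes S \<and>
              ((f ^^ t) (f y), ?pol ((f ^^ t) (f y))) \<in> region S (i t) \<Longrightarrow>
            (\<Sum>t<N. stage_cost S (i t) ((f ^^ t) (f y)) (?pol ((f ^^ t) (f y)))) \<le> V (vstar (f y))"
        by blast
      \<comment> \<open>The first step is peeled off rather than the last, so
        \<open>funpow.simps(2)\<close> is removed from the simplifier wherever \<open>shift\<close>
        has to act.\<close>
      have shift: "(f ^^ Suc t) y = (f ^^ t) (f y)" for t
        by (simp add: funpow_swap1)
      show ?thesis
      proof (intro exI[of _ "Suc N"] conjI allI impI)
        fix t assume "t < Suc N"
        then show "(f ^^ t) y \<notin> goal S"
          using N(1) False by (cases t) (simp_all add: shift del: funpow.simps(2))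
      next
        fix t assume "t \<le> Suc N"
        then show "(f ^^ t) y \<in> tree_set T"
          using N(2) less.prems by (cases t) (simp_all add: shift del: funpow.simps(2))
      next
        show "(f ^^ Suc N) y \<in> goal S"
          using N(3) by (simp only: shift)
      next
        fix i assume i: "\<forall>t<Suc N. i t \<in> modes S \<and> ((f ^^ t) y, ?pol ((f ^^ t) y)) \<in> region S (i t)"
        have "stage_cost S (i 0) y (?pol y) \<le> worst_cost S T (vstar y)"
          using i by (intro st(5)) auto
        moreover have "(\<Sum>t<N. stage_cost S (i (Suc t)) ((f ^^ t) (f y)) (?pol ((f ^^ t) (f y))))
            \<le> V (vstar (f y))"
          using i by (intro cost) (metis Suc_mono shift)
        \<comment> \<open>Splitting off the term at time 0 leaves the cost of the orbit of
          \<open>f y\<close> under the modes \<open>i (Suc t)\<close>; the two bounds add up to at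
          most \<open>V (vstar y)\<close>.\<close>
        ultimately show "(\<Sum>t<Suc N. stage_cost S (i t) ((f ^^ t) y) (?pol ((f ^^ t) y))) \<le> V (vstar y)"
          using st(3) by (simp add: sum.lessThan_Suc_shift shift del: funpow.simps(2) sum.lessThan_Suc)
      qed
    qed
  qed
  from this[OF x0] obtain N
    where N: "\<forall>t<N. (f ^^ t) x0 \<notin> goal S" "\<forall>t\<le>N. (f ^^ t) x0 \<in> tree_set T" "(f ^^ N) x0 \<in> goal S"
      "\<forall>i. (\<forall>t<N. i t \<in> modes S \<and> ((f ^^ t) x0, ?pol ((f ^^ t) x0)) \<in> region S (i t)) \<longrightarrow>
        (\<Sum>t<N. stage_cost S (i t) ((f ^^ t) x0) (?pol ((f ^^ t) x0))) \<le> V (vstar x0)"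
    by blast
  show ?thesis
    by (rule exI[of _ N], rule exI[of _ "\<lambda>t. (f ^^ t) x0"], rule exI[of _ "\<lambda>t. ?pol ((f ^^ t) x0)"])
      (use N step(1) in \<open>simp add: f_def\<close>)
qed

end
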